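(* Let $\mathcal{A}$ be a finite abelian group admitting a perfect pairing $\langle\cdot,\cdot\rangle:\mathcal{A}\times\mathcal{A}\to\mathbb{Q}/\mathbb{Z}$, and write $\sim$ for equality up to multiplication by squares of nonzero rational numbers. (1) If $\langle\cdot,\cdot\rangle$ is antisymmetric, then $|\mathcal{A}|$ is either a square or twice a square, and it is a square if and only if $\mathcal{A}$ admits a perfect alternating pairing. Moreover, for every positive integer $e$, $|\mathcal{A}[e]|\sim|\mathcal{A}|$ if $e$ is even and $|\mathcal{A}[e]|\sim1$ if $e$ is odd. (2) If $F\in\mathrm{Aut}(\mathcal{A})$ and $\langle\cdot,\cdot\rangle$ is symmetric and $F$-invariant, then for every integer $f$, $|\mathcal{A}^{F^f}|\sim|\mathcal{A}^F|$ if $f$ is odd and $|\mathcal{A}^{F^f}|\sim|\mathcal{A}|$ if $f$ is even.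
   Context: $\mathcal{A}[e]$ is the $e$-torsion subgroup and $\mathcal{A}^{F^f}$ the subgroup fixed by $F^f$. *)

theory Defs
  imports "HOL-Algebra.Algebra" "HOL-Computational_Algebra.Nth_Powers"
begin

text \<open>Abelian groups are written multiplicatively, as everywhere in HOL-Algebra. In particular
  the group \<open>\<rat>/\<int>\<close> below has product \<open>(a + \<int>) \<otimes> (b + \<int>) = (a + b) + \<int>\<close> and unit \<open>\<int>\<close>.\<close>

definition rational_group :: "rat monoid"
  where "rational_group = \<lparr>carrier = UNIV, monoid.mult = (+), one = 0\<rparr>"

definition Q_mod_Z :: "rat set monoid"
  where "Q_mod_Z = rational_group Mod \<int>"

text \<open>The group \<open>Hom(A, \<rat>/\<int>)\<close>; homomorphisms are taken to be extensional, since
  \<^const>\<open>hom\<close> does not determine values outside the carrier.\<close>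

definition dual_group :: "('a, 'b) monoid_scheme \<Rightarrow> ('a \<Rightarrow> rat set) monoid"
  where "dual_group A =
    \<lparr>carrier = hom A Q_mod_Z \<inter> extensional (carrier A),
     monoid.mult = (\<lambda>\<phi> \<psi>. \<lambda>x\<in>carrier A. \<phi> x \<otimes>\<^bsub>Q_mod_Z\<^esub> \<psi> x),
     one = (\<lambda>x\<in>carrier A. \<one>\<^bsub>Q_mod_Z\<^esub>)\<rparr>"

definition pairing :: "('a, 'b) monoid_scheme \<Rightarrow> ('a \<Rightarrow> 'a \<Rightarrow> rat set) \<Rightarrow> bool"
  where "pairing A B \<longleftrightarrow>
    (\<forall>x\<in>carrier A. (\<lambda>y. B x y) \<in> hom A Q_mod_Z) \<and>
    (\<forall>y\<in>carrier A. (\<lambda>x. B x y) \<in> hom A Q_mod_Z)"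

definition perfect_pairing :: "('a, 'b) monoid_scheme \<Rightarrow> ('a \<Rightarrow> 'a \<Rightarrow> rat set) \<Rightarrow> bool"
  where "perfect_pairing A B \<longleftrightarrow> pairing A B \<and>
    (\<lambda>x. \<lambda>y\<in>carrier A. B x y) \<in> iso A (dual_group A) \<and>
    (\<lambda>y. \<lambda>x\<in>carrier A. B x y) \<in> iso A (dual_group A)"

definition symmetric_pairing :: "('a, 'b) monoid_scheme \<Rightarrow> ('a \<Rightarrow> 'a \<Rightarrow> rat set) \<Rightarrow> bool"
  where "symmetric_pairing A B \<longleftrightarrow> (\<forall>x\<in>carrier A. \<forall>y\<in>carrier A. B x y = B y x)"

definition antisymmetric_pairing :: "('a, 'b) monoid_scheme \<Rightarrow> ('a \<Rightarrow> 'a \<Rightarrow> rat set) \<Rightarrow> bool"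
  where "antisymmetric_pairing A B \<longleftrightarrow>
    (\<forall>x\<in>carrier A. \<forall>y\<in>carrier A. B x y = inv\<^bsub>Q_mod_Z\<^esub> (B y x))"

definition alternating_pairing :: "('a, 'b) monoid_scheme \<Rightarrow> ('a \<Rightarrow> 'a \<Rightarrow> rat set) \<Rightarrow> bool"
  where "alternating_pairing A B \<longleftrightarrow> (\<forall>x\<in>carrier A. B x x = \<one>\<^bsub>Q_mod_Z\<^esub>)"

definition invariant_pairing ::
    "('a, 'b) monoid_scheme \<Rightarrow> ('a \<Rightarrow> 'a) \<Rightarrow> ('a \<Rightarrow> 'a \<Rightarrow> rat set) \<Rightarrow> bool"
  where "invariant_pairing A F B \<longleftrightarrow>
    (\<forall>x\<in>carrier A. \<forall>y\<in>carrier A. B (F x) (F y) = B x y)"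

definition torsion :: "('a, 'b) monoid_scheme \<Rightarrow> nat \<Rightarrow> 'a set"
  where "torsion A e = {x \<in> carrier A. x [^]\<^bsub>A\<^esub> e = \<one>\<^bsub>A\<^esub>}"

definition fixed_subgroup :: "('a, 'b) monoid_scheme \<Rightarrow> ('a \<Rightarrow> 'a) \<Rightarrow> 'a set"
  where "fixed_subgroup A F = {x \<in> carrier A. F x = x}"

definition eq_mod_squares :: "rat \<Rightarrow> rat \<Rightarrow> bool"  (infix \<open>\<sim>\<^sub>\<box>\<close> 50)
  where "a \<sim>\<^sub>\<box> b \<longleftrightarrow> (\<exists>q. q \<noteq> 0 \<and> a = b * q\<^sup>2)"

lemma comm_group_rational_group: "comm_group rational_group"
proof (rule comm_groupI)
  fix x assume "x \<in> carrier rational_group"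
  show "\<exists>y\<in>carrier rational_group. y \<otimes>\<^bsub>rational_group\<^esub> x = \<one>\<^bsub>rational_group\<^esub>"
    by (rule bexI[of _ "- x"]) (auto simp: rational_group_def)
qed (auto simp: rational_group_def)

lemma subgroup_Ints_rational_group: "subgroup \<int> rational_group"
proof (rule group.subgroupI)
  show "group rational_group"
    using comm_group_rational_group by (simp add: comm_group_def)
  fix a :: rat assume "a \<in> \<int>"
  have "inv\<^bsub>rational_group\<^esub> a = - a"
    by (rule group.inv_equality[OF \<open>group rational_group\<close>]) (auto simp: rational_group_def)
  then show "inv\<^bsub>rational_group\<^esub> a \<in> \<int>" using \<open>a \<in> \<int>\<close> by simp
next
  show "(\<int> :: rat set) \<noteq> {}" using Ints_0 by blast
qed (auto simp: rational_group_def)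

lemma comm_group_Q_mod_Z: "comm_group Q_mod_Z"
  unfolding Q_mod_Z_def
  by (rule comm_group.abelian_FactGroup[OF comm_group_rational_group subgroup_Ints_rational_group])

end

theory Submission
  imports Defs Complex_Main
begin

text \<open>Everything reduces to one fact: if \<open>\<beta>\<close> is an alternating pairing on a finite abelian group
  \<open>G\<close>, perfect or not, then \<open>|G| |rad \<beta>|\<close> is a square. Indeed, character sums over the rows and
  columns of \<open>\<beta>\<close> give \<open>|H| |H\<^sup>\<bottom>| = |G| |H \<inter> rad \<beta>|\<close> for every subgroup \<open>H\<close>, and a maximal
  isotropic \<open>H\<close> equals \<open>H\<^sup>\<bottom>\<close>.

  For an antisymmetric pairing and even \<open>e\<close> the form \<open>\<langle>e x, y\<rangle>\<close> is alternating with radical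
  \<open>A[e]\<close>; odd \<open>e\<close> follows from \<open>|A[2e]| = |A[e]| |A[2]|\<close>.

  For a symmetric \<open>F\<close>-invariant pairing and any endomorphism \<open>q\<close> the form
  \<open>\<langle>q x, y\<rangle> - \<langle>q y, x\<rangle>\<close> is alternating. Taking \<open>q = F\<^sup>g\<close> the radical is \<open>ker (F\<^sup>2\<^sup>g - 1)\<close>, and
  taking \<open>q = F\<^sup>g\<^sup>+\<^sup>1 + F\<^sup>g\<close> it is \<open>ker ((F + 1)(F\<^sup>f - 1))\<close> with \<open>f = 2g + 1\<close>. The map \<open>F\<^sup>f - 1\<close>
  sends the latter kernel onto a subgroup that does not depend on the odd number \<open>f\<close>, so comparing
  with \<open>f = 1\<close> gives the odd case.\<close>

section \<open>Embedding of \<open>Q_mod_Z\<close> into the complex unit circle\<close>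

text \<open>This is q + Z \<mapsto> exp(2 pi i q). On cosets the choice made by \<open>SOME\<close>
  is immaterial because \<open>cis\<close> has period 2 pi. Complex values make character sums
  available.\<close>

definition qz_char :: "rat set \<Rightarrow> complex"
  where "qz_char u = cis (2 * pi * of_rat (SOME q. q \<in> u))"

lemma carrier_Q_mod_Z: "carrier Q_mod_Z = range (\<lambda>q. {q + of_int n |n. True})"
  by (auto simp: Q_mod_Z_def FactGroup_def RCOSETS_def r_coset_def rational_group_def
      Ints_def add.commute)

lemma one_Q_mod_Z: "\<one>\<^bsub>Q_mod_Z\<^esub> = \<int>"
  by (simp add: Q_mod_Z_def FactGroup_def)

lemma add_mem_mult_Q_mod_Z: "p \<in> u \<Longrightarrow> q \<in> v \<Longrightarrow> p + q \<in> u \<otimes>\<^bsub>Q_mod_Z\<^esub> v"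
  by (auto simp: Q_mod_Z_def FactGroup_def set_mult_def rational_group_def)

lemma qz_char_eq:
  assumes "u \<in> carrier Q_mod_Z" and "q \<in> u"
  shows "qz_char u = cis (2 * pi * of_rat q)"
proof -
  have "(SOME q. q \<in> u) \<in> u" using assms(2) by (rule someI)
  then obtain n where "(SOME q. q \<in> u) = q + of_int n"
    using assms unfolding carrier_Q_mod_Z
    by clarsimp (metis add.assoc add_diff_cancel_left' diff_add_cancel of_int_diff of_int_add add.commute)
  then show ?thesis
    by (simp add: qz_char_def of_rat_add distrib_left flip: cis_mult)
qed

lemma Q_mod_Z_nonempty: "u \<in> carrier Q_mod_Z \<Longrightarrow> \<exists>q. q \<in> u"
  by (auto simp: carrier_Q_mod_Z)

lemma qz_char_mult:
  assumes "u \<in> carrier Q_mod_Z" and "v \<in> carrier Q_mod_Z"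
  shows "qz_char (u \<otimes>\<^bsub>Q_mod_Z\<^esub> v) = qz_char u * qz_char v"
proof -
  interpret Q: comm_group Q_mod_Z by (rule comm_group_Q_mod_Z)
  obtain p q where "p \<in> u" "q \<in> v" using assms Q_mod_Z_nonempty by blast
  then show ?thesis
    using assms qz_char_eq[OF Q.m_closed[OF assms] add_mem_mult_Q_mod_Z]
    by (simp add: qz_char_eq of_rat_add distrib_left flip: cis_mult)
qed

lemma qz_char_eq_1_iff:
  assumes "u \<in> carrier Q_mod_Z"
  shows "qz_char u = 1 \<longleftrightarrow> u = \<one>\<^bsub>Q_mod_Z\<^esub>"
proof
  obtain q where q: "u = {q + of_int n |n. True}" using assms by (auto simp: carrier_Q_mod_Z)
  then have "q \<in> u" by (auto intro: exI[of _ 0])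
  note char_u = qz_char_eq[OF assms this]
  assume "qz_char u = 1"
  \<comment> \<open>The real part suffices: a cosine equal to 1 already forces the angle to be a
    multiple of 2 pi.\<close>
  then have "cos (2 * pi * of_rat q) = 1" by (metis char_u cis.sel(1) one_complex.sel(1))
  then obtain n :: int where "2 * pi * of_rat q = n * 2 * pi" by (auto simp: cos_one_2pi_int)
  then have "(of_rat q :: real) = of_rat (of_int n)" by simp
  then have "q = of_int n" by (simp only: of_rat_eq_iff)
  have "x \<in> u" if "x \<in> \<int>" for x
    using that unfolding q \<open>q = of_int n\<close> Ints_def
    by clarsimp (metis add_diff_cancel_left' diff_add_cancel of_int_diff of_int_add add.commute)
  then show "u = \<one>\<^bsub>Q_mod_Z\<^esub>" using q \<open>q = of_int n\<close> by (auto simp: one_Q_mod_Z)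
next
  assume "u = \<one>\<^bsub>Q_mod_Z\<^esub>"
  then show "qz_char u = 1" using qz_char_eq[OF assms, of 0] by (simp add: one_Q_mod_Z)
qed

lemma qz_char_nonzero: "qz_char u \<noteq> 0"
  by (simp add: qz_char_def)

section \<open>Bicharacters on a finite abelian group\<close>

text \<open>Nondegeneracy is not built in, so that the locale also covers the degenerate forms
  obtained by twisting a perfect pairing with endomorphisms.\<close>

locale finite_bicharacter = comm_group G for G (structure) +
  fixes b :: "'a \<Rightarrow> 'a \<Rightarrow> complex"
  assumes finite_carrier: "finite (carrier G)"
    and mult_left: "\<lbrakk>x \<in> carrier G; y \<in> carrier G; z \<in> carrier G\<rbrakk> \<Longrightarrow> b (x \<otimes> y) z = b x z * b y z"
    and mult_right: "\<lbrakk>x \<in> carrier G; y \<in> carrier G; z \<in> carrier G\<rbrakk> \<Longrightarrow> b z (x \<otimes> y) = b z x * b z y"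
    and nonzero: "\<lbrakk>x \<in> carrier G; y \<in> carrier G\<rbrakk> \<Longrightarrow> b x y \<noteq> 0"
begin

lemma one_left [simp]: "x \<in> carrier G \<Longrightarrow> b \<one> x = 1"
  using mult_left[of \<one> \<one> x] nonzero[of \<one> x] by simp

lemma one_right [simp]: "x \<in> carrier G \<Longrightarrow> b x \<one> = 1"
  using mult_right[of \<one> \<one> x] nonzero[of x \<one>] by simp

lemma pow_left: "x \<in> carrier G \<Longrightarrow> y \<in> carrier G \<Longrightarrow> b (x [^] (n::nat)) y = b x y ^ n"
  by (induction n) (auto simp: mult_left)

lemma inv_left: "x \<in> carrier G \<Longrightarrow> y \<in> carrier G \<Longrightarrow> b (inv x) y = inverse (b x y)"
  using mult_left[of x "inv x" y] nonzero[of x y] by (simp add: inverse_unique)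

lemma inv_right: "x \<in> carrier G \<Longrightarrow> y \<in> carrier G \<Longrightarrow> b x (inv y) = inverse (b x y)"
  using mult_right[of y "inv y" x] nonzero[of x y] by (simp add: inverse_unique)

definition radical where "radical = {x \<in> carrier G. \<forall>y\<in>carrier G. b x y = 1}"

definition orthogonal where "orthogonal S = {y \<in> carrier G. \<forall>x\<in>S. b x y = 1}"

lemma subgroup_orthogonal: "S \<subseteq> carrier G \<Longrightarrow> subgroup (orthogonal S) G"
  by (rule subgroupI) (auto simp: orthogonal_def mult_right inv_right subset_iff)

end

text \<open>Translating the summation variable by \<open>a\<close> multiplies the sum by
  \<open>\<psi> a\<close>, so the sum vanishes once some \<open>\<psi> a\<close> differs from
  1.\<close>

lemma (in group) sum_character:
  fixes \<psi> :: "'a \<Rightarrow> complex"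
  assumes "finite H" "subgroup H G"
    and mult: "\<And>x y. x \<in> H \<Longrightarrow> y \<in> H \<Longrightarrow> \<psi> (x \<otimes> y) = \<psi> x * \<psi> y"
  shows "(\<Sum>x\<in>H. \<psi> x) = (if \<forall>x\<in>H. \<psi> x = 1 then of_nat (card H) else 0)"
proof (cases "\<forall>x\<in>H. \<psi> x = 1")
  case False
  then obtain a where a: "a \<in> H" "\<psi> a \<noteq> 1" by blast
  interpret H: subgroup H G by fact
  have "(\<Sum>x\<in>H. \<psi> x) = (\<Sum>x\<in>H. \<psi> (a \<otimes> x))"
    by (rule sum.reindex_bij_witness[of _ "\<lambda>x. a \<otimes> x" "\<lambda>x. inv a \<otimes> x"])
       (use a in \<open>auto simp flip: m_assoc\<close>)
  also have "\<dots> = \<psi> a * (\<Sum>x\<in>H. \<psi> x)" using a by (simp add: mult sum_distrib_left)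
  finally show ?thesis using a by auto
qed auto

context finite_bicharacter
begin

text \<open>Both sides evaluate the sum of \<open>b x y\<close> over \<open>x\<close> in
  \<open>H\<close> and \<open>y\<close> in \<open>G\<close>: a row survives only for
  \<open>x\<close> in \<open>radical\<close>, a column only for \<open>y\<close> in
  \<open>orthogonal H\<close>.\<close>

lemma card_mult_card_orthogonal:
  assumes "subgroup H G"
  shows "card H * card (orthogonal H) = card (carrier G) * card (H \<inter> radical)"
proof -
  interpret H: subgroup H G by fact
  have fin: "finite H" using H.subset finite_carrier finite_subset by blast
  have row: "(\<Sum>y\<in>carrier G. b x y) = (if x \<in> radical then of_nat (card (carrier G)) else 0)"
    if "x \<in> H" for x
    using sum_character[OF finite_carrier subgroup_self, of "b x"] that
    by (auto simp: mult_right radical_def)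
  have col: "(\<Sum>x\<in>H. b x y) = (if y \<in> orthogonal H then of_nat (card H) else 0)"
    if "y \<in> carrier G" for y
    using sum_character[OF fin assms, of "\<lambda>x. b x y"] that
    by (auto simp: mult_left orthogonal_def)
  have "(of_nat (card (carrier G) * card (H \<inter> radical)) :: complex) = (\<Sum>x\<in>H. \<Sum>y\<in>carrier G. b x y)"
    using fin by (simp add: row sum.If_cases Int_def)
  also have "\<dots> = (\<Sum>y\<in>carrier G. \<Sum>x\<in>H. b x y)" by (rule sum.swap)
  also have "\<dots> = of_nat (card H * card (carrier G \<inter> orthogonal H))"
    using finite_carrier by (simp add: col sum.If_cases Int_def)
  also have "carrier G \<inter> orthogonal H = orthogonal H" by (auto simp: orthogonal_def)
  finally show ?thesis by (metis of_nat_eq_iff)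
qed

lemma alternating_imp_antisymmetric:
  assumes "\<And>x. x \<in> carrier G \<Longrightarrow> b x x = 1" and "x \<in> carrier G" "y \<in> carrier G"
  shows "b x y * b y x = 1"
proof -
  have "b (x \<otimes> y) (x \<otimes> y) = b x x * b x y * (b y x * b y y)"
    using assms(2,3) by (simp add: mult_left mult_right del: assms(1))
  then show ?thesis using assms by simp
qed

text \<open>A maximal isotropic subgroup \<open>H\<close> of an alternating form is its own orthogonal complement,
  since any \<open>x\<close> orthogonal to \<open>H\<close> can be adjoined to it; so \<open>|H|\<^sup>2 = |G| |rad|\<close>.\<close>

lemma alternating_card_radical:
  assumes alt: "\<And>x. x \<in> carrier G \<Longrightarrow> b x x = 1"
  shows "\<exists>m. card (carrier G) * card radical = m\<^sup>2"
proof -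
  have anti: "b y x = 1" if "b x y = 1" "x \<in> carrier G" "y \<in> carrier G" for x y
    using alternating_imp_antisymmetric[OF alt, of x y] that by simp
  define I where "I = {H. subgroup H G \<and> H \<subseteq> orthogonal H}"
  have "I \<subseteq> Pow (carrier G)" by (auto simp: I_def orthogonal_def)
  then have "finite I" using finite_carrier by (meson finite_Pow_iff finite_subset)
  moreover have "{\<one>} \<in> I" by (auto simp: I_def orthogonal_def triv_subgroup)
  ultimately obtain H where "H \<in> I" and max: "\<And>K. K \<in> I \<Longrightarrow> H \<subseteq> K \<Longrightarrow> H = K"
    using finite_has_maximal[of I] by blast
  then have H: "subgroup H G" and iso: "H \<subseteq> orthogonal H" by (auto simp: I_def)
  interpret H: subgroup H G by fact
  have "orthogonal H \<subseteq> H"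
  proof
    fix x assume x: "x \<in> orthogonal H"
    then have xG: "x \<in> carrier G" by (simp add: orthogonal_def)
    define S where "S = insert x H"
    have S: "S \<subseteq> carrier G" using xG by (auto simp: S_def)
    \<comment> \<open>From here isotropy passes from the generators \<open>S\<close> to the
      generated subgroup, one argument at a time, with \<open>anti\<close> exchanging the arguments
      in between.\<close>
    have "S \<subseteq> orthogonal S"
      using x xG iso alt anti by (auto simp: S_def orthogonal_def)
    then have "generate G S \<subseteq> orthogonal S"
      by (rule generate_subgroup_incl) (rule subgroup_orthogonal[OF S])
    moreover have gen: "generate G S \<subseteq> carrier G" using S by (rule generate_incl)
    ultimately have "S \<subseteq> orthogonal (generate G S)"
      using S anti by (fastforce simp: orthogonal_def)
    then have "generate G S \<subseteq> orthogonal (generate G S)"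
      by (rule generate_subgroup_incl) (rule subgroup_orthogonal[OF gen])
    then have "generate G S \<in> I" using generate_is_subgroup[OF S] by (simp add: I_def)
    moreover have "S \<subseteq> generate G S" by (auto intro: generate.incl)
    ultimately show "x \<in> H" using max[of "generate G S"] by (auto simp: S_def)
  qed
  with iso have "orthogonal H = H" by blast
  \<comment> \<open>Hence \<open>H \<inter> radical\<close> is all of \<open>radical\<close>, and
    the counting identity becomes |H|^2 = |G| |rad|.\<close>
  moreover have "radical \<subseteq> orthogonal H" using anti by (auto simp: radical_def orthogonal_def)
  ultimately show ?thesis
    using card_mult_card_orthogonal[OF H] by (metis inf.absorb2 power2_eq_square)
qed

lemma eq_iff_if_radical_trivial:
  assumes "radical = {\<one>}" "u \<in> carrier G" "v \<in> carrier G"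
  shows "(\<forall>z\<in>carrier G. b u z = b v z) \<longleftrightarrow> u = v"
proof (intro iffI)
  assume "\<forall>z\<in>carrier G. b u z = b v z"
  then have "u \<otimes> inv v \<in> radical"
    using assms(2,3) nonzero by (simp add: radical_def mult_left inv_left)
  then show "u = v" using assms by (metis inv_equality inv_inv inv_closed singletonD)
qed simp

text \<open>Since \<open>b x x\<close> squares to 1, an even power \<open>e\<close> makes the form
  \<open>b (x [^] e) y\<close> alternating; by nondegeneracy its radical is the
  \<open>e\<close>-torsion.\<close>

lemma card_torsion_even:
  assumes nondeg: "radical = {\<one>}"
    and anti: "\<And>x y. x \<in> carrier G \<Longrightarrow> y \<in> carrier G \<Longrightarrow> b x y * b y x = 1"
    and "even e"
  shows "\<exists>m. card (carrier G) * card (torsion G e) = m\<^sup>2"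
proof -
  interpret E: finite_bicharacter G "\<lambda>x y. b (x [^] e) y"
    by unfold_locales
      (auto simp: finite_carrier nat_pow_distrib mult_left mult_right nonzero)
  have "b (x [^] e) x = 1" if "x \<in> carrier G" for x
  proof -
    obtain k where "e = 2 * k" using \<open>even e\<close> by blast
    then show ?thesis
      using that anti[of x x] by (simp add: pow_left power_mult power2_eq_square)
  qed
  then have "\<exists>m. card (carrier G) * card E.radical = m\<^sup>2" by (rule E.alternating_card_radical)
  moreover have "E.radical = torsion G e"
    using nondeg by (auto simp: E.radical_def radical_def torsion_def)
  ultimately show ?thesis by simp
qed

text \<open>The form \<open>\<langle>q x, y\<rangle> - \<langle>q y, x\<rangle>\<close> is alternating for every endomorphism \<open>q\<close>; the
  remaining hypotheses say that it equals \<open>\<langle>(r - t) x, s y\<rangle>\<close>, which identifies its radical.\<close>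

lemma card_radical_skew:
  assumes nondeg: "radical = {\<one>}" and q: "q \<in> hom G G" and s: "s ` carrier G = carrier G"
    and r: "r \<in> carrier G \<rightarrow> carrier G" and t: "t \<in> carrier G \<rightarrow> carrier G"
    and qr: "\<And>x y. x \<in> carrier G \<Longrightarrow> y \<in> carrier G \<Longrightarrow> b (q x) y = b (r x) (s y)"
    and qt: "\<And>x y. x \<in> carrier G \<Longrightarrow> y \<in> carrier G \<Longrightarrow> b (q y) x = b (t x) (s y)"
  shows "\<exists>m. card (carrier G) * card {x \<in> carrier G. r x = t x} = m\<^sup>2"
proof -
  have qG: "q x \<in> carrier G" if "x \<in> carrier G" for x using q that by (auto simp: hom_def)
  have qm: "q (x \<otimes> y) = q x \<otimes> q y" if "x \<in> carrier G" "y \<in> carrier G" for x y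
    using q that by (auto simp: hom_def)
  \<comment> \<open>Written multiplicatively, the difference of the two forms is a quotient, which
    is visibly 1 for \<open>x = y\<close>.\<close>
  interpret E: finite_bicharacter G "\<lambda>x y. b (q x) y / b (q y) x"
    by unfold_locales (auto simp: finite_carrier mult_left mult_right nonzero qG qm)
  have "\<exists>m. card (carrier G) * card E.radical = m\<^sup>2"
    by (rule E.alternating_card_radical) (simp add: nonzero qG)
  moreover have "x \<in> E.radical \<longleftrightarrow> r x = t x" if x: "x \<in> carrier G" for x
  proof -
    have "x \<in> E.radical \<longleftrightarrow> (\<forall>y\<in>carrier G. b (q x) y = b (q y) x)"
      using x nonzero qG by (auto simp: E.radical_def)
    also have "\<dots> \<longleftrightarrow> (\<forall>y\<in>carrier G. b (r x) (s y) = b (t x) (s y))"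
      using x by (metis qr qt)
    \<comment> \<open>Surjectivity of \<open>s\<close> lets \<open>s y\<close> run through the whole
      group.\<close>
    also have "\<dots> \<longleftrightarrow> (\<forall>z\<in>carrier G. b (r x) z = b (t x) z)"
      by (subst s[symmetric]) blast
    also have "\<dots> \<longleftrightarrow> r x = t x"
      using x r t by (intro eq_iff_if_radical_trivial nondeg) auto
    finally show ?thesis .
  qed
  then have "E.radical = {x \<in> carrier G. r x = t x}" by (auto simp: E.radical_def)
  ultimately show ?thesis by simp
qed

end

section \<open>Kernel-image counting, torsion and square classes\<close>

text \<open>The nonempty fibres of \<open>h\<close> on \<open>P\<close> are translates of the
  kernel, so they all have the same size.\<close>

lemma (in group) card_eq_card_kernel_mult_card_image:
  assumes "finite P" "subgroup P G" "h \<in> hom G G"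
  shows "card P = card {x \<in> P. h x = \<one>} * card (h ` P)"
proof -
  interpret P: subgroup P G by fact
  interpret h: group_hom G G h by unfold_locales fact
  have "card {x \<in> P. h x = h a} = card {x \<in> P. h x = \<one>}" if "a \<in> P" for a
    by (rule bij_betw_same_card[of "\<lambda>x. inv a \<otimes> x"], rule bij_betw_byWitness[of _ "\<lambda>x. a \<otimes> x"])
       (use that in \<open>auto simp flip: m_assoc\<close>)
  then have "card {x \<in> P. h x = y} = card {x \<in> P. h x = \<one>}" if "y \<in> h ` P" for y
    using that by blast
  then have "(\<Sum>y\<in>h ` P. card {x \<in> P. h x = y}) = card (h ` P) * card {x \<in> P. h x = \<one>}"
    by simp
  moreover have "card P = (\<Sum>y\<in>h ` P. card {x \<in> P. h x = y})"
    using sum.image_gen[OF assms(1), of "\<lambda>_. 1::nat" h] by simp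
  ultimately show ?thesis by simp
qed

text \<open>The \<open>e\<close>-th power map sends the 2e-torsion to the 2-torsion with kernel the
  \<open>e\<close>-torsion. It is onto because, \<open>e\<close> being odd, it is the identity on
  2-torsion.\<close>

lemma (in comm_group) card_torsion_double:
  assumes "finite (carrier G)" "odd e"
  shows "card (torsion G (2 * e)) = card (torsion G e) * card (torsion G 2)"
proof -
  have sub: "subgroup (torsion G n) G" for n
    by (rule subgroupI) (auto simp: torsion_def nat_pow_distrib nat_pow_inv)
  have pow: "(\<lambda>x. x [^] e) \<in> hom G G" by (auto simp: hom_def nat_pow_distrib)
  have "{x \<in> torsion G (2 * e). x [^] e = \<one>} = torsion G e"
    by (auto simp: torsion_def mult.commute[of 2] simp flip: nat_pow_pow)
  moreover have "(\<lambda>x. x [^] e) ` torsion G (2 * e) = torsion G 2"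
  proof (intro equalityI subsetI)
    fix y assume y: "y \<in> torsion G 2"
    obtain k where "e = 2 * k + 1" using \<open>odd e\<close> by (rule oddE)
    then have "y [^] e = y"
      using y by (simp add: torsion_def flip: nat_pow_mult nat_pow_pow)
    moreover have "y \<in> torsion G (2 * e)"
      using y by (simp add: torsion_def flip: nat_pow_pow)
    ultimately show "y \<in> (\<lambda>x. x [^] e) ` torsion G (2 * e)" by force
  qed (auto simp: torsion_def nat_pow_pow mult.commute)
  ultimately show ?thesis
    using card_eq_card_kernel_mult_card_image[OF _ sub pow, of "2 * e"] assms(1)
    by (simp add: torsion_def)
qed

text \<open>The witness is m/b, as a = b (m/b)^2; positivity makes it nonzero.\<close>

lemma eq_mod_squares_of_nat:
  assumes "b * a = m\<^sup>2" "a > 0" "b > 0"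
  shows "of_nat a \<sim>\<^sub>\<box> of_nat b"
proof -
  have "of_nat b * of_nat a = (of_nat m :: rat)\<^sup>2" by (metis assms(1) of_nat_mult of_nat_power)
  then have "of_nat a = of_nat b * (of_nat m / of_nat b :: rat)\<^sup>2"
    using assms(3) by (simp add: power_divide power2_eq_square[of "of_nat b"] flip: \<open>_ = (of_nat m)\<^sup>2\<close>)
  moreover have "m \<noteq> 0" using assms by (auto intro: ccontr)
  ultimately show ?thesis
    unfolding eq_mod_squares_def using assms(3) by (intro exI[of _ "of_nat m / of_nat b"]) simp
qed

lemma eq_mod_squares_cancel:
  assumes "a * c \<sim>\<^sub>\<box> d" "b * c \<sim>\<^sub>\<box> d" "c \<noteq> 0"
  shows "a \<sim>\<^sub>\<box> b"
proof -
  obtain p q where pq: "p \<noteq> 0" "a * c = d * p\<^sup>2" "q \<noteq> 0" "b * c = d * q\<^sup>2"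
    using assms by (auto simp: eq_mod_squares_def)
  then have "a * c = b * (p / q)\<^sup>2 * c" by (simp add: field_simps power2_eq_square)
  then have "a = b * (p / q)\<^sup>2" using \<open>c \<noteq> 0\<close> by simp
  then show ?thesis using pq unfolding eq_mod_squares_def by (intro exI[of _ "p / q"]) simp
qed

lemma (in comm_group) funpow_hom: "F \<in> hom G G \<Longrightarrow> F ^^ n \<in> hom G G"
  by (induction n) (auto simp: hom_def Pi_iff)

text \<open>\<open>P n\<close> is \<open>ker ((F + 1)(F\<^sup>n - 1))\<close>, and \<open>k\<close> is the order of its image under \<open>F\<^sup>n - 1\<close>, which is
  \<open>ker (F + 1) \<inter> im (F - 1)\<close>: if \<open>y = (F - 1) x\<close> and \<open>(F + 1) y = 0\<close> then \<open>F\<^sup>2 x = x\<close>, so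
  \<open>F\<^sup>n x = F x\<close>.\<close>

lemma (in comm_group) fixed_subgroup_funpow_odd:
  fixes n :: nat and F :: "'a \<Rightarrow> 'a"
  defines "P \<equiv> \<lambda>n. {x \<in> carrier G. (F ^^ Suc n) x \<otimes> (F ^^ n) x = F x \<otimes> x}"
  assumes "finite (carrier G)" and F: "F \<in> hom G G" and "odd n"
  obtains k where "k > 0"
    and "card (P n) = card (fixed_subgroup G (F ^^ n)) * k"
    and "card (P 1) = card (fixed_subgroup G F) * k"
proof -
  have FG [simp]: "(F ^^ m) x \<in> carrier G" if "x \<in> carrier G" for x m
    using funpow_hom[OF F, of m] that by (auto simp: hom_def)
  note FG1 [simp] = FG[where m = 1, simplified]
  have Fmult: "(F ^^ m) (x \<otimes> y) = (F ^^ m) x \<otimes> (F ^^ m) y"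
    if "x \<in> carrier G" "y \<in> carrier G" for x y m
    using funpow_hom[OF F, of m] that by (auto simp: hom_def)
  interpret F: group_hom G G F by unfold_locales fact
  \<comment> \<open>In additive notation \<open>h m\<close> is F^m - 1.\<close>
  define h where "h m x = (F ^^ m) x \<otimes> inv x" for m x
  have h: "h m \<in> hom G G" for m
    by (auto simp: hom_def h_def Fmult inv_mult m_ac)
  have hG [simp]: "h m x \<in> carrier G" if "x \<in> carrier G" for m x
    using that by (simp add: h_def)
  \<comment> \<open>This is the factorization F^(m+1) + F^m - F - 1 = (F + 1)(F^m - 1).\<close>
  have P: "P m = {x \<in> carrier G. F (h m x) \<otimes> h m x = \<one>}" for m
  proof -
    have "F (h m x) \<otimes> h m x = ((F ^^ Suc m) x \<otimes> (F ^^ m) x) \<otimes> inv (F x \<otimes> x)"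
      if "x \<in> carrier G" for x
      using that by (simp add: h_def inv_mult m_ac)
    then show ?thesis
      unfolding P_def by (auto simp: inv_solve_right' simp del: funpow.simps)
  qed
  have sub: "subgroup (P m) G" for m
  proof -
    interpret h: group_hom G G "h m" by unfold_locales (rule h)
    show ?thesis
    proof (rule subgroupI)
      fix x y assume "x \<in> P m" "y \<in> P m"
      then have xy: "x \<in> carrier G" "y \<in> carrier G" "F (h m x) \<otimes> h m x = \<one>" "F (h m y) \<otimes> h m y = \<one>"
        by (auto simp: P)
      then have "F (h m (x \<otimes> y)) \<otimes> h m (x \<otimes> y) = (F (h m x) \<otimes> h m x) \<otimes> (F (h m y) \<otimes> h m y)"
        by (simp add: m_ac)
      then show "x \<otimes> y \<in> P m" using xy by (simp add: P)
      have "F (h m (inv x)) \<otimes> h m (inv x) = inv (F (h m x) \<otimes> h m x)"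
        using xy(1) by (simp add: inv_mult)
      then show "inv x \<in> P m" using xy by (simp add: P)
    next
      have "\<one> \<in> P m" by (simp add: P)
      then show "P m \<noteq> {}" by blast
    qed (auto simp: P)
  qed
  have fin: "finite (P m)" for m using assms(2) by (simp add: P)
  have ker: "{x \<in> P m. h m x = \<one>} = fixed_subgroup G (F ^^ m)" for m
    by (auto simp: P fixed_subgroup_def h_def inv_solve_right')
  \<comment> \<open>F - 1 divides F^m - 1; the induction uses F^(m+1) - 1 = (F - 1) F^m + (F^m -
    1).\<close>
  have range_h: "h m ` carrier G \<subseteq> h 1 ` carrier G" for m
  proof (induction m)
    case 0
    have "h 0 x = h 1 \<one>" if "x \<in> carrier G" for x using that by (simp add: h_def)
    then show ?case by auto
  next
    case (Suc m)
    show ?case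
    proof clarify
      fix x assume x: "x \<in> carrier G"
      then obtain z where z: "z \<in> carrier G" "h m x = h 1 z" using Suc by blast
      have "h (Suc m) x = h 1 ((F ^^ m) x) \<otimes> h m x"
      proof -
        have "u \<otimes> inv v \<otimes> (v \<otimes> w) = u \<otimes> w"
          if "u \<in> carrier G" "v \<in> carrier G" "w \<in> carrier G" for u v w
          using that by (metis inv_closed inv_solve_right' m_assoc m_closed)
        from this[of "(F ^^ Suc m) x" "(F ^^ m) x" "inv x"] show ?thesis using x by (simp add: h_def)
      qed
      also have "\<dots> = h 1 ((F ^^ m) x \<otimes> z)"
        using x z hom_mult[OF h] by simp
      finally show "h (Suc m) x \<in> h 1 ` carrier G" using x z by simp
    qed
  qed
  have "h n ` P n = h 1 ` P 1"
  proof (intro equalityI subsetI)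
    fix y assume "y \<in> h n ` P n"
    then have "y \<in> h n ` carrier G" "F y \<otimes> y = \<one>" by (auto simp: P)
    then obtain z where "z \<in> carrier G" "y = h 1 z" using range_h by blast
    \<comment> \<open>With \<open>y = h 1 z\<close>, the equation for \<open>y\<close> is exactly
      the condition \<open>z \<in> P 1\<close>.\<close>
    then show "y \<in> h 1 ` P 1" using \<open>F y \<otimes> y = \<one>\<close> by (auto simp: P)
  next
    fix y assume "y \<in> h 1 ` P 1"
    then obtain x where x: "x \<in> P 1" "y = h 1 x" by blast
    then have xG: "x \<in> carrier G" by (simp add: P)
    \<comment> \<open>For exponent 1 the defining equation of \<open>P\<close> is F^2 x + F x = F x
      + x, and F x cancels.\<close>
    then have period: "(F ^^ 2) x = x"
      using x by (simp add: P_def numeral_2_eq_2 m_comm[of _ "F x"])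
    obtain k where k: "n = Suc (2 * k)" using \<open>odd n\<close> by (metis oddE Suc_eq_plus1)
    have "((F ^^ 2) ^^ k) x = x"
      by (induction k) (simp_all add: period funpow_Suc_right del: funpow.simps(2))
    then have "(F ^^ n) x = F x" by (simp add: k funpow_mult)
    then have "h n x = y" using x by (simp add: h_def)
    moreover have "x \<in> P n" using x \<open>h n x = y\<close> by (simp add: P)
    ultimately show "y \<in> h n ` P n" by blast
  qed
  moreover have "card (P m) = card (fixed_subgroup G (F ^^ m)) * card (h m ` P m)" for m
    using card_eq_card_kernel_mult_card_image[OF fin sub h, of m m] unfolding ker .
  ultimately have eq: "card (P n) = card (fixed_subgroup G (F ^^ n)) * card (h 1 ` P 1)"
    "card (P 1) = card (fixed_subgroup G (F ^^ 1)) * card (h 1 ` P 1)" by metis+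
  have "card (h 1 ` P 1) > 0"
    using fin subgroup.one_closed[OF sub] by (auto simp: card_gt_0_iff)
  then show ?thesis using that eq by simp
qed

section \<open>Fixed points under symmetric invariant forms\<close>

context finite_bicharacter
begin

context
  fixes F :: "'a \<Rightarrow> 'a"
  assumes nondeg: "radical = {\<one>}"
    and F: "F \<in> hom G G" and surj: "F ` carrier G = carrier G"
    and sym: "\<And>x y. x \<in> carrier G \<Longrightarrow> y \<in> carrier G \<Longrightarrow> b x y = b y x"
    and inv: "\<And>x y. x \<in> carrier G \<Longrightarrow> y \<in> carrier G \<Longrightarrow> b (F x) (F y) = b x y"
begin

lemma funpow_closed: "x \<in> carrier G \<Longrightarrow> (F ^^ n) x \<in> carrier G"
  using funpow_hom[OF F, of n] by (auto simp: hom_def)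

lemma funpow_surj: "(F ^^ n) ` carrier G = carrier G"
proof (induction n)
  case (Suc n)
  then show ?case using surj by (metis funpow.simps(2) image_comp)
qed simp

lemma funpow_invariant:
  "x \<in> carrier G \<Longrightarrow> y \<in> carrier G \<Longrightarrow> b ((F ^^ n) x) ((F ^^ n) y) = b x y"
  by (induction n) (simp_all add: inv funpow_closed)

text \<open>The skew form of q = F^g has s = F^g, r = F^(2g) and t = 1: invariance moves the first
  term by F^g, symmetry turns the second.\<close>

lemma card_fixed_even:
  "\<exists>m. card (carrier G) * card (fixed_subgroup G (F ^^ (2 * g))) = m\<^sup>2"
proof -
  have "\<exists>m. card (carrier G) * card {x \<in> carrier G. (F ^^ (2 * g)) x = x} = m\<^sup>2"
  proof (rule card_radical_skew[OF nondeg funpow_hom[OF F, of g] funpow_surj[of g]])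
    fix x y assume xy: "x \<in> carrier G" "y \<in> carrier G"
    show "b ((F ^^ g) x) y = b ((F ^^ (2 * g)) x) ((F ^^ g) y)"
      using funpow_invariant[of "(F ^^ g) x" y g] xy
      by (simp add: funpow_closed mult_2 funpow_add)
    show "b ((F ^^ g) y) x = b x ((F ^^ g) y)"
      using xy by (simp add: sym funpow_closed)
  qed (auto simp: funpow_closed)
  then show ?thesis by (simp add: fixed_subgroup_def)
qed

text \<open>Here q = F^(g+1) + F^g and s = F^(g+1). Shifting each term by invariance gives r =
  F^(n+1) + F^n and t = F + 1, whose difference is (F + 1)(F^n - 1).\<close>

lemma card_fixed_mult_succ:
  fixes g :: nat
  defines "n \<equiv> 2 * g + 1"
  shows "\<exists>m. card (carrier G) * card {x \<in> carrier G. (F ^^ Suc n) x \<otimes> (F ^^ n) x = F x \<otimes> x} = m\<^sup>2"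
proof -
  have FG: "F x \<in> carrier G" if "x \<in> carrier G" for x
    using F that by (auto simp: hom_def)
  have "F ^^ Suc g \<in> hom G G" "F ^^ g \<in> hom G G" by (rule funpow_hom[OF F])+
  then have q: "(\<lambda>x. (F ^^ Suc g) x \<otimes> (F ^^ g) x) \<in> hom G G"
    by (auto simp: hom_def Pi_iff m_ac simp del: funpow.simps)
  show ?thesis
  proof (rule card_radical_skew[OF nondeg q funpow_surj[of "Suc g"]])
    fix x y assume xy: "x \<in> carrier G" "y \<in> carrier G"
    have "b ((F ^^ Suc g) x) y = b ((F ^^ Suc n) x) ((F ^^ Suc g) y)"
      using funpow_invariant[of "(F ^^ Suc g) x" y "Suc g"] xy
      by (simp add: funpow_closed n_def mult_2 del: funpow.simps
          flip: funpow_add[THEN fun_cong, unfolded comp_def])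
    moreover have "b ((F ^^ g) x) y = b ((F ^^ n) x) ((F ^^ Suc g) y)"
      using funpow_invariant[of "(F ^^ g) x" y "Suc g"] xy
      by (simp add: funpow_closed n_def mult_2 del: funpow.simps
          flip: funpow_add[THEN fun_cong, unfolded comp_def])
    ultimately show "b ((F ^^ Suc g) x \<otimes> (F ^^ g) x) y
        = b ((F ^^ Suc n) x \<otimes> (F ^^ n) x) ((F ^^ Suc g) y)"
      using xy by (simp add: mult_left funpow_closed del: funpow.simps)
    have "b ((F ^^ g) y) x = b (F x) ((F ^^ Suc g) y)"
      using xy inv[of x "(F ^^ g) y"] by (simp add: funpow_closed sym)
    moreover have "b ((F ^^ Suc g) y) x = b x ((F ^^ Suc g) y)"
      using xy by (simp add: sym funpow_closed del: funpow.simps)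
    ultimately show "b ((F ^^ Suc g) y \<otimes> (F ^^ g) y) x = b (F x \<otimes> x) ((F ^^ Suc g) y)"
      using xy by (simp add: mult_left funpow_closed FG del: funpow.simps)
  qed (auto simp: funpow_closed FG simp del: funpow.simps)
qed

text \<open>The orders of \<open>P n\<close> and \<open>P 1\<close> both lie in the square class of
  |G| and contain the same factor \<open>k\<close>, which cancels.\<close>

lemma card_fixed_odd:
  assumes "odd n"
  shows "of_nat (card (fixed_subgroup G (F ^^ n))) \<sim>\<^sub>\<box> of_nat (card (fixed_subgroup G F))"
proof -
  define P where "P n = {x \<in> carrier G. (F ^^ Suc n) x \<otimes> (F ^^ n) x = F x \<otimes> x}" for n
  obtain k where "k > 0" and k: "card (P n) = card (fixed_subgroup G (F ^^ n)) * k"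
    "card (P 1) = card (fixed_subgroup G F) * k"
    using fixed_subgroup_funpow_odd[OF finite_carrier F assms] unfolding P_def by blast
  have "of_nat (card (P (2 * g + 1))) \<sim>\<^sub>\<box> of_nat (card (carrier G))" for g
  proof -
    obtain m where "card (carrier G) * card (P (2 * g + 1)) = m\<^sup>2"
      using card_fixed_mult_succ[of g] unfolding P_def by blast
    moreover have "\<one> \<in> P (2 * g + 1)"
      using hom_one[OF F is_group] hom_one[OF funpow_hom[OF F] is_group]
      by (simp add: P_def is_group del: funpow.simps)
    then have "card (P (2 * g + 1)) > 0"
      using finite_carrier by (auto simp: card_gt_0_iff P_def)
    moreover have "card (carrier G) > 0"
      using finite_carrier one_closed by (auto simp: card_gt_0_iff)
    ultimately show ?thesis by (rule eq_mod_squares_of_nat)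
  qed
  from this[of 0] this[of "n div 2"] \<open>odd n\<close>
  have "of_nat (card (P 1)) \<sim>\<^sub>\<box> of_nat (card (carrier G))"
    "of_nat (card (P n)) \<sim>\<^sub>\<box> of_nat (card (carrier G))"
    by simp_all
  then show ?thesis
    using \<open>k > 0\<close> eq_mod_squares_cancel[of _ "of_nat k"] unfolding k of_nat_mult
    by (metis of_nat_0_eq_iff less_numeral_extra(3))
qed

end

end

section \<open>Integer powers in the automorphism group\<close>

lemma AutoGroup_mult_apply:
  "H \<in> auto G \<Longrightarrow> K \<in> auto G \<Longrightarrow> x \<in> carrier G \<Longrightarrow> (H \<otimes>\<^bsub>AutoGroup G\<^esub> K) x = H (K x)"
  by (simp add: AutoGroup_def BijGroup_def auto_def compose_def)

text \<open>Elements of \<open>AutoGroup G\<close> are composed with restriction to the carrier, so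
  agreement with \<open>F ^^ n\<close> is claimed only there.\<close>

lemma (in group) AutoGroup_nat_pow_apply:
  assumes "F \<in> auto G" "x \<in> carrier G"
  shows "(F [^]\<^bsub>AutoGroup G\<^esub> (n::nat)) x = (F ^^ n) x"
  using assms(2)
proof (induction n arbitrary: x)
  case 0
  then show ?case by (simp add: AutoGroup_def BijGroup_def)
next
  case (Suc n)
  interpret Aut: group "AutoGroup G" by (rule AutoGroup)
  have "F [^]\<^bsub>AutoGroup G\<^esub> n \<in> auto G"
    using assms(1) Aut.nat_pow_closed[of F n] by (simp add: AutoGroup_def)
  then have "(F [^]\<^bsub>AutoGroup G\<^esub> Suc n) x = (F [^]\<^bsub>AutoGroup G\<^esub> n) (F x)"
    using assms(1) Suc.prems by (simp add: AutoGroup_mult_apply)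
  moreover have "F x \<in> carrier G" using assms(1) Suc.prems by (auto simp: auto_def hom_def)
  ultimately show ?case using Suc.IH[of "F x"] by (simp add: funpow_swap1)
qed

text \<open>An automorphism and its inverse fix the same elements, so the sign of \<open>f\<close>
  does not matter.\<close>

lemma (in group) fixed_subgroup_int_pow:
  assumes F: "F \<in> auto G"
  shows "fixed_subgroup G (F [^]\<^bsub>AutoGroup G\<^esub> (f::int)) = fixed_subgroup G (F ^^ nat \<bar>f\<bar>)"
proof -
  interpret Aut: group "AutoGroup G" by (rule AutoGroup)
  have carr: "carrier (AutoGroup G) = auto G" by (simp add: AutoGroup_def)
  have nat_case: "fixed_subgroup G (F [^]\<^bsub>AutoGroup G\<^esub> n) = fixed_subgroup G (F ^^ n)" for n :: nat
    using F by (auto simp: fixed_subgroup_def AutoGroup_nat_pow_apply)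
  have inv_case: "fixed_subgroup G (inv\<^bsub>AutoGroup G\<^esub> H) = fixed_subgroup G H" if "H \<in> auto G" for H
  proof -
    have le: "fixed_subgroup G K \<subseteq> fixed_subgroup G (inv\<^bsub>AutoGroup G\<^esub> K)" if "K \<in> auto G" for K
    proof
      fix x assume "x \<in> fixed_subgroup G K"
      then have x: "x \<in> carrier G" "K x = x" by (auto simp: fixed_subgroup_def)
      have "inv\<^bsub>AutoGroup G\<^esub> K \<in> auto G" using that Aut.inv_closed[of K] by (simp add: carr)
      moreover have "(inv\<^bsub>AutoGroup G\<^esub> K \<otimes>\<^bsub>AutoGroup G\<^esub> K) x = x"
        using that x Aut.l_inv[of K] by (simp add: carr) (simp add: AutoGroup_def BijGroup_def)
      ultimately have "(inv\<^bsub>AutoGroup G\<^esub> K) x = x"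
        using x that by (simp add: AutoGroup_mult_apply)
      then show "x \<in> fixed_subgroup G (inv\<^bsub>AutoGroup G\<^esub> K)" using x by (simp add: fixed_subgroup_def)
    qed
    show ?thesis
      using le[OF that] le[of "inv\<^bsub>AutoGroup G\<^esub> H"] that Aut.inv_closed[of H] Aut.inv_inv[of H]
      by (auto simp: carr)
  qed
  show ?thesis
  proof (cases f rule: int_cases2)
    case (nonneg n)
    then show ?thesis using nat_case[of n] by (simp add: int_pow_int)
  next
    case (nonpos n)
    then show ?thesis
      using nat_case[of n] inv_case[of "F [^]\<^bsub>AutoGroup G\<^esub> n"] F Aut.nat_pow_closed[of F n]
      by (simp add: Aut.int_pow_neg_int carr)
  qed
qed

section \<open>Perfect pairings and their bicharacters\<close>

text \<open>Nondegeneracy gives injectivity, and equal finite orders then give surjectivity. The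
  order of the dual is a hypothesis because an already given perfect pairing supplies it.\<close>

lemma (in comm_group) iso_dual_groupI:
  fixes B :: "'a \<Rightarrow> 'a \<Rightarrow> rat set"
  assumes fin: "finite (carrier G)" and card: "card (carrier (dual_group G)) = card (carrier G)"
    and left: "\<And>x. x \<in> carrier G \<Longrightarrow> (\<lambda>y. B x y) \<in> hom G Q_mod_Z"
    and right: "\<And>y. y \<in> carrier G \<Longrightarrow> (\<lambda>x. B x y) \<in> hom G Q_mod_Z"
    and nondeg: "\<And>x. x \<in> carrier G \<Longrightarrow> (\<And>y. y \<in> carrier G \<Longrightarrow> B x y = \<one>\<^bsub>Q_mod_Z\<^esub>) \<Longrightarrow> x = \<one>"
  shows "(\<lambda>x. \<lambda>y\<in>carrier G. B x y) \<in> iso G (dual_group G)"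
proof -
  interpret Q: comm_group Q_mod_Z by (rule comm_group_Q_mod_Z)
  have mult: "B (x \<otimes> x') y = B x y \<otimes>\<^bsub>Q_mod_Z\<^esub> B x' y"
    if "x \<in> carrier G" "x' \<in> carrier G" "y \<in> carrier G" for x x' y
    using right[of y] that by (auto simp: hom_def)
  have closed: "B x y \<in> carrier Q_mod_Z" if "x \<in> carrier G" "y \<in> carrier G" for x y
    using left[of x] that by (auto simp: hom_def)
  let ?h = "\<lambda>x. \<lambda>y\<in>carrier G. B x y"
  have maps: "?h ` carrier G \<subseteq> carrier (dual_group G)"
    using left by (auto simp: dual_group_def hom_def)
  have "?h (x \<otimes> x') = ?h x \<otimes>\<^bsub>dual_group G\<^esub> ?h x'" if "x \<in> carrier G" "x' \<in> carrier G" for x x'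
    using that by (auto simp: dual_group_def mult intro!: restrict_ext)
  with maps have hom: "?h \<in> hom G (dual_group G)"
    by (intro homI) blast+
  have "inj_on ?h (carrier G)"
  proof (rule inj_onI)
    fix x x' assume x: "x \<in> carrier G" "x' \<in> carrier G" "?h x = ?h x'"
    have "x \<otimes> inv x' = \<one>"
    proof (rule nondeg)
      fix y assume y: "y \<in> carrier G"
      then interpret r: group_hom G Q_mod_Z "\<lambda>x. B x y"
        using right by unfold_locales auto
      have "B x y = B x' y" using x(3) y by (metis restrict_apply')
      then show "B (x \<otimes> inv x') y = \<one>\<^bsub>Q_mod_Z\<^esub>"
        using x(1,2) y by (simp add: closed)
    qed (use x in simp)
    then show "x = x'" using x by (metis inv_equality inv_inv inv_closed)
  qed
  \<comment> \<open>An infinite set would have \<open>card\<close> equal to 0, but the order of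
    \<open>G\<close> is positive.\<close>
  moreover have "finite (carrier (dual_group G))"
    using card fin by (metis card_eq_0_iff carrier_not_empty)
  ultimately have "?h ` carrier G = carrier (dual_group G)"
    using maps card by (metis card_image card_subset_eq)
  with hom \<open>inj_on ?h (carrier G)\<close> show ?thesis by (simp add: iso_def bij_betw_def)
qed

locale finite_perfect_pairing = comm_group A for A (structure) +
  fixes B :: "'a \<Rightarrow> 'a \<Rightarrow> rat set"
  assumes finite_carrier: "finite (carrier A)" and perfect: "perfect_pairing A B"
begin

lemma hom_left: "x \<in> carrier A \<Longrightarrow> B x \<in> hom A Q_mod_Z"
  using perfect by (auto simp: perfect_pairing_def pairing_def)

lemma hom_right: "y \<in> carrier A \<Longrightarrow> (\<lambda>x. B x y) \<in> hom A Q_mod_Z"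
  using perfect by (auto simp: perfect_pairing_def pairing_def)

lemma closed [simp]: "x \<in> carrier A \<Longrightarrow> y \<in> carrier A \<Longrightarrow> B x y \<in> carrier Q_mod_Z"
  using hom_left by (auto simp: hom_def)

lemma mult_left:
  "\<lbrakk>x \<in> carrier A; y \<in> carrier A; z \<in> carrier A\<rbrakk> \<Longrightarrow> B (x \<otimes> y) z = B x z \<otimes>\<^bsub>Q_mod_Z\<^esub> B y z"
  using hom_right[of z] by (auto simp: hom_def)

lemma mult_right:
  "\<lbrakk>x \<in> carrier A; y \<in> carrier A; z \<in> carrier A\<rbrakk> \<Longrightarrow> B z (x \<otimes> y) = B z x \<otimes>\<^bsub>Q_mod_Z\<^esub> B z y"
  using hom_left[of z] by (auto simp: hom_def)

definition b where "b x y = qz_char (B x y)"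

sublocale b: finite_bicharacter A b
  by unfold_locales
    (auto simp: finite_carrier b_def mult_left mult_right qz_char_mult qz_char_nonzero)

lemma b_eq_1_iff: "x \<in> carrier A \<Longrightarrow> y \<in> carrier A \<Longrightarrow> b x y = 1 \<longleftrightarrow> B x y = \<one>\<^bsub>Q_mod_Z\<^esub>"
  by (simp add: b_def qz_char_eq_1_iff)

text \<open>A radical element induces the same character as the unit, so injectivity of the map to
  the dual identifies them.\<close>

lemma radical_trivial: "b.radical = {\<one>}"
proof -
  have inj: "inj_on (\<lambda>x. \<lambda>y\<in>carrier A. B x y) (carrier A)"
    using perfect by (auto simp: perfect_pairing_def iso_def bij_betw_def)
  have "x = \<one>" if "x \<in> b.radical" for x
  proof (rule inj_onD[OF inj])
    show "(\<lambda>y\<in>carrier A. B x y) = (\<lambda>y\<in>carrier A. B \<one> y)"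
      using that b.one_left by (intro restrict_ext)
        (metis (mono_tags, lifting) b.radical_def b_eq_1_iff mem_Collect_eq one_closed)
  qed (use that in \<open>auto simp: b.radical_def\<close>)
  moreover have "\<one> \<in> b.radical" by (simp add: b.radical_def)
  ultimately show ?thesis by blast
qed

lemma card_dual_group: "card (carrier (dual_group A)) = card (carrier A)"
  using perfect by (auto simp: perfect_pairing_def iso_def dest: bij_betw_same_card)

lemma card_carrier_pos: "card (carrier A) > 0"
  using finite_carrier one_closed by (auto simp: card_gt_0_iff)

lemma alternating_imp_is_square:
  assumes "alternating_pairing A B"
  shows "is_square (order A)"
proof -
  have "b x x = 1" if "x \<in> carrier A" for x
    using assms that by (simp add: b_eq_1_iff alternating_pairing_def)
  then show ?thesis
    using b.alternating_card_radical
    by (auto simp: radical_trivial order_def is_nth_power_def)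
qed

end

section \<open>Antisymmetric pairings\<close>

text \<open>For an antisymmetric pairing \<open>x \<mapsto> \<langle>x, x\<rangle>\<close> is a homomorphism, hence equal to \<open>\<langle>\<cdot>, c\<rangle>\<close> for some
  \<open>c\<close> of order at most 2. Shearing the second argument along \<open>c\<close> makes the pairing alternating, at
  the price of the kernel \<open>{0, c}\<close> when \<open>\<langle>c, c\<rangle> \<noteq> 0\<close>.\<close>

locale finite_antisymmetric_pairing = finite_perfect_pairing +
  assumes antisymmetric: "antisymmetric_pairing A B"
begin

lemma b_antisymmetric: "x \<in> carrier A \<Longrightarrow> y \<in> carrier A \<Longrightarrow> b x y * b y x = 1"
proof -
  interpret Q: comm_group Q_mod_Z by (rule comm_group_Q_mod_Z)
  assume xy: "x \<in> carrier A" "y \<in> carrier A"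
  then have "B x y \<otimes>\<^bsub>Q_mod_Z\<^esub> B y x = \<one>\<^bsub>Q_mod_Z\<^esub>"
    using antisymmetric by (metis Q.l_inv antisymmetric_pairing_def closed)
  then show ?thesis
    using xy by (metis Q.one_closed b_def closed qz_char_eq_1_iff qz_char_mult)
qed

lemma b_square_self: "x \<in> carrier A \<Longrightarrow> b x x * b x x = 1"
  by (rule b_antisymmetric)

text \<open>Antisymmetry cancels the cross terms of
  \<open>B (x \<otimes> y) (x \<otimes> y)\<close>, and perfectness in the second argument
  represents the resulting character. As \<open>b x x\<close> is its own inverse,
  \<open>c \<otimes> c\<close> lies in the radical.\<close>

lemma obtain_characteristic_element:
  obtains c where "c \<in> carrier A" "c \<otimes> c = \<one>" "\<And>x. x \<in> carrier A \<Longrightarrow> b x c = b x x"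
proof -
  interpret Q: comm_group Q_mod_Z by (rule comm_group_Q_mod_Z)
  have "B (x \<otimes> y) (x \<otimes> y) = B x x \<otimes>\<^bsub>Q_mod_Z\<^esub> B y y"
    if xy: "x \<in> carrier A" "y \<in> carrier A" for x y
  proof -
    have "B x y = inv\<^bsub>Q_mod_Z\<^esub> B y x"
      using antisymmetric xy unfolding antisymmetric_pairing_def by blast
    moreover have "B (x \<otimes> y) (x \<otimes> y)
        = B x x \<otimes>\<^bsub>Q_mod_Z\<^esub> B y y \<otimes>\<^bsub>Q_mod_Z\<^esub> (B x y \<otimes>\<^bsub>Q_mod_Z\<^esub> B y x)"
      using xy by (simp add: mult_left mult_right Q.m_ac)
    ultimately show ?thesis using xy by simp
  qed
  then have "(\<lambda>x\<in>carrier A. B x x) \<in> carrier (dual_group A)"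
    by (auto simp: dual_group_def hom_def)
  moreover have "(\<lambda>y. \<lambda>x\<in>carrier A. B x y) ` carrier A = carrier (dual_group A)"
    using perfect by (auto simp: perfect_pairing_def iso_def bij_betw_def)
  ultimately have "(\<lambda>x\<in>carrier A. B x x) \<in> (\<lambda>y. \<lambda>x\<in>carrier A. B x y) ` carrier A" by simp
  then obtain c where eq: "(\<lambda>x\<in>carrier A. B x x) = (\<lambda>x\<in>carrier A. B x c)"
    and c: "c \<in> carrier A" by (rule imageE)
  have bc: "b x c = b x x" if "x \<in> carrier A" for x
    using fun_cong[OF eq, of x] that by (simp add: b_def)
  have "b (c \<otimes> c) x = 1" if x: "x \<in> carrier A" for x
  proof -
    have "b c x * b x x = 1" using b_antisymmetric[of c x] c x by (simp add: bc)
    then have "b c x = b x x"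
      using b_square_self[OF x] by (metis mult_cancel_right mult_zero_right zero_neq_one)
    then show ?thesis using b_square_self[OF x] c x by (simp add: b.mult_left)
  qed
  then have "c \<otimes> c \<in> b.radical" using c by (simp add: b.radical_def)
  with c bc show ?thesis using that by (simp add: radical_trivial)
qed

text \<open>The value \<open>b c c\<close> decides: if it is 1, the shear is injective and the
  sheared pairing stays perfect; otherwise its radical has order 2, and 2|A| is a square.\<close>

lemma alternating_or_twice_square:
  "(\<exists>B'. perfect_pairing A B' \<and> alternating_pairing A B') \<or> (\<exists>n. order A = 2 * n\<^sup>2)"
proof -
  obtain c where c: "c \<in> carrier A" "c \<otimes> c = \<one>" and bc: "\<And>x. x \<in> carrier A \<Longrightarrow> b x c = b x x"
    by (rule obtain_characteristic_element) blast
  define \<theta> where "\<theta> y = (if b y y = 1 then y else y \<otimes> c)" for y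
  have \<theta>G [simp]: "\<theta> y \<in> carrier A" if "y \<in> carrier A" for y using that c by (simp add: \<theta>_def)
  have \<theta>_mult: "\<theta> (x \<otimes> y) = \<theta> x \<otimes> \<theta> y" if xy: "x \<in> carrier A" "y \<in> carrier A" for x y
  proof -
    have pm: "b z z = 1 \<or> b z z = - 1" if "z \<in> carrier A" for z
      using b_square_self[OF that] by (simp add: square_eq_1_iff)
    have "b (x \<otimes> y) (x \<otimes> y) = b x x * b y y * (b x y * b y x)"
      using xy by (simp add: b.mult_left b.mult_right)
    then have "b (x \<otimes> y) (x \<otimes> y) = b x x * b y y" using xy by (simp add: b_antisymmetric)
    moreover have "(x \<otimes> c) \<otimes> (y \<otimes> c) = x \<otimes> y"
    proof -
      have "(x \<otimes> c) \<otimes> (y \<otimes> c) = (x \<otimes> y) \<otimes> (c \<otimes> c)" using xy c(1) by (simp add: m_ac)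
      then show ?thesis using xy c by simp
    qed
    \<comment> \<open>The sign \<open>b z z\<close> is multiplicative; when both signs are -1, the
      two factors \<open>c\<close> cancel.\<close>
    ultimately show ?thesis
      using pm[of x] pm[of y] xy c(1) by (auto simp: \<theta>_def m_ac)
  qed
  have kernel: "y = \<one> \<or> y = c \<and> b c c \<noteq> 1" if "y \<in> carrier A" "\<theta> y = \<one>" for y
    using that c by (auto simp: \<theta>_def split: if_splits)
      (metis inv_equality inv_inv inv_closed)+
  define B' where "B' x y = B x (\<theta> y)" for x y
  \<comment> \<open>If \<open>b x x\<close> is not 1, then \<open>b x (x \<otimes> c)\<close> is the
    square of \<open>b x x\<close>.\<close>
  have alt: "b x (\<theta> x) = 1" if "x \<in> carrier A" for x
    using that c b_square_self by (simp add: \<theta>_def b.mult_right bc)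
  interpret b': finite_bicharacter A "\<lambda>x y. b x (\<theta> y)"
    by unfold_locales
      (auto simp: finite_carrier b.mult_left b.mult_right b.nonzero \<theta>_mult)
  have left_iff: "(\<forall>x\<in>carrier A. b x (\<theta> y) = 1) \<longleftrightarrow> \<theta> y = \<one>" if y: "y \<in> carrier A" for y
  proof -
    have "(\<forall>x\<in>carrier A. b x (\<theta> y) = 1) \<longleftrightarrow> (\<forall>x\<in>carrier A. b (\<theta> y) x = 1)"
      using b_antisymmetric[OF _ \<theta>G[OF y]] by (metis mult_1 mult.right_neutral)
    also have "\<dots> \<longleftrightarrow> \<theta> y \<in> b.radical" using y by (simp add: b.radical_def)
    finally show ?thesis by (simp add: radical_trivial)
  qed
  \<comment> \<open>\<open>left_iff\<close> describes the second-argument kernel; antisymmetry of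
    the sheared form carries it over to \<open>radical\<close>, which concerns the first
    argument.\<close>
  have "b x (\<theta> y) = 1 \<longleftrightarrow> b y (\<theta> x) = 1" if "x \<in> carrier A" "y \<in> carrier A" for x y
    using b'.alternating_imp_antisymmetric[OF alt that] by (metis mult_1 mult.right_neutral)
  then have radical': "b'.radical = {y \<in> carrier A. \<theta> y = \<one>}"
    using left_iff by (auto simp: b'.radical_def)
  show ?thesis
  proof (cases "b c c = 1")
    case True
    have hom1: "B' x \<in> hom A Q_mod_Z" if "x \<in> carrier A" for x
      using that by (auto simp: B'_def hom_def \<theta>_mult mult_right)
    have hom2: "(\<lambda>x. B' x y) \<in> hom A Q_mod_Z" if "y \<in> carrier A" for y
      using that by (auto simp: B'_def hom_right)
    have one_iff: "B' x y = \<one>\<^bsub>Q_mod_Z\<^esub> \<longleftrightarrow> b x (\<theta> y) = 1"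
      if "x \<in> carrier A" "y \<in> carrier A" for x y
      using that by (simp add: B'_def b_eq_1_iff)
    have "(\<lambda>x. \<lambda>y\<in>carrier A. B' x y) \<in> iso A (dual_group A)"
    proof (rule iso_dual_groupI[OF finite_carrier card_dual_group hom1 hom2])
      fix x assume "x \<in> carrier A" "\<And>y. y \<in> carrier A \<Longrightarrow> B' x y = \<one>\<^bsub>Q_mod_Z\<^esub>"
      then have "x \<in> b'.radical" by (simp add: b'.radical_def one_iff)
      then show "x = \<one>" using kernel True by (auto simp: radical')
    qed auto
    moreover have "(\<lambda>y. \<lambda>x\<in>carrier A. B' x y) \<in> iso A (dual_group A)"
    proof (rule iso_dual_groupI[OF finite_carrier card_dual_group hom2 hom1])
      fix y assume "y \<in> carrier A" "\<And>x. x \<in> carrier A \<Longrightarrow> B' x y = \<one>\<^bsub>Q_mod_Z\<^esub>"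
      then have "\<theta> y = \<one>" using left_iff[of y] by (simp add: one_iff)
      then show "y = \<one>" using kernel True \<open>y \<in> carrier A\<close> by auto
    qed auto
    ultimately have "perfect_pairing A B'"
      using hom1 hom2 by (simp add: perfect_pairing_def pairing_def)
    moreover have "alternating_pairing A B'"
      using alt by (simp add: alternating_pairing_def one_iff)
    ultimately show ?thesis by blast
  next
    case False
    then have "c \<noteq> \<one>" by auto
    moreover have "\<theta> \<one> = \<one>" "\<theta> c = \<one>" using False c by (simp_all add: \<theta>_def)
    then have "{y \<in> carrier A. \<theta> y = \<one>} = {\<one>, c}" using kernel c by blast
    ultimately have "card b'.radical = 2" by (simp add: radical')
    then obtain m where m: "card (carrier A) * 2 = m\<^sup>2"
      using b'.alternating_card_radical[OF alt] by auto
    then have "even m" by (metis dvd_triv_right even_power pos2)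
    then obtain n where "m = 2 * n" by blast
    with m have "order A = 2 * n\<^sup>2" by (simp add: order_def power2_eq_square)
    then show ?thesis by blast
  qed
qed

lemma card_torsion_pos: "card (torsion A e) > 0"
proof -
  have "\<one> \<in> torsion A e" by (simp add: torsion_def)
  then show ?thesis using finite_carrier by (auto simp: torsion_def card_gt_0_iff)
qed

lemma torsion_even:
  assumes "even e"
  shows "of_nat (card (torsion A e)) \<sim>\<^sub>\<box> of_nat (order A)"
  using b.card_torsion_even[OF radical_trivial b_antisymmetric assms]
    eq_mod_squares_of_nat card_torsion_pos card_carrier_pos
  unfolding order_def by blast

text \<open>The 2e-torsion and the 2-torsion both have order in the class of |A|, so their quotient,
  the order of the \<open>e\<close>-torsion, is a square class of 1.\<close>

lemma torsion_odd:
  assumes "odd e"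
  shows "of_nat (card (torsion A e)) \<sim>\<^sub>\<box> 1"
proof (rule eq_mod_squares_cancel)
  show "of_nat (card (torsion A e)) * of_nat (card (torsion A 2)) \<sim>\<^sub>\<box> of_nat (order A)"
    using torsion_even[of "2 * e"] card_torsion_double[OF finite_carrier assms] by simp
  show "1 * of_nat (card (torsion A 2)) \<sim>\<^sub>\<box> of_nat (order A)"
    using torsion_even[of 2] by simp
  show "of_nat (card (torsion A 2)) \<noteq> (0 :: rat)"
    using card_torsion_pos[of 2] by simp
qed

end

text \<open>The exponent of 2 is even in a nonzero square and odd in twice one.\<close>

lemma not_is_square_twice_square:
  fixes n :: nat
  assumes "n > 0"
  shows "\<not> is_square (2 * n\<^sup>2)"
proof
  assume "is_square (2 * n\<^sup>2)"
  then obtain m where m: "m\<^sup>2 = 2 * n\<^sup>2" by (auto simp: is_nth_power_def)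
  then have "m \<noteq> 0" using assms by (intro notI) simp
  have "2 * multiplicity 2 m = multiplicity 2 (m\<^sup>2)"
    using \<open>m \<noteq> 0\<close> by (simp add: prime_elem_multiplicity_power_distrib)
  also have "\<dots> = 1 + 2 * multiplicity 2 n"
    using assms unfolding m
    by (subst prime_elem_multiplicity_mult_distrib) (auto simp: prime_elem_multiplicity_power_distrib)
  finally show False by presburger
qed

theorem theorem2p4p1:
  fixes A :: "('a, 'b) monoid_scheme" and B :: "'a \<Rightarrow> 'a \<Rightarrow> rat set"
  assumes "comm_group A" and "finite (carrier A)" and "perfect_pairing A B"
  shows "(antisymmetric_pairing A B \<longrightarrow>
            (is_square (order A) \<or> (\<exists>n. order A = 2 * n\<^sup>2)) \<and>
            (is_square (order A) \<longleftrightarrow>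
              (\<exists>B'. perfect_pairing A B' \<and> alternating_pairing A B')) \<and>
            (\<forall>e>0. (even e \<longrightarrow> of_nat (card (torsion A e)) \<sim>\<^sub>\<box> of_nat (order A)) \<and>
                   (odd e \<longrightarrow> of_nat (card (torsion A e)) \<sim>\<^sub>\<box> 1))) \<and>
         (\<forall>F\<in>auto A. symmetric_pairing A B \<and> invariant_pairing A F B \<longrightarrow>
            (\<forall>f::int.
              (odd f \<longrightarrow> of_nat (card (fixed_subgroup A (F [^]\<^bsub>AutoGroup A\<^esub> f)))
                           \<sim>\<^sub>\<box> of_nat (card (fixed_subgroup A F))) \<and>
              (even f \<longrightarrow> of_nat (card (fixed_subgroup A (F [^]\<^bsub>AutoGroup A\<^esub> f)))
                           \<sim>\<^sub>\<box> of_nat (order A))))"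
proof (intro conjI impI ballI)
  interpret finite_perfect_pairing A B
    using assms by (simp add: finite_perfect_pairing_def finite_perfect_pairing_axioms_def)
  {
    assume "antisymmetric_pairing A B"
    then interpret finite_antisymmetric_pairing A B by unfold_locales
    have square: "is_square (order A)" if "perfect_pairing A B'" "alternating_pairing A B'" for B'
      using that assms finite_perfect_pairing.alternating_imp_is_square[of A B']
      by (simp add: finite_perfect_pairing_def finite_perfect_pairing_axioms_def)
    then show "is_square (order A) \<or> (\<exists>n. order A = 2 * n\<^sup>2)"
      using alternating_or_twice_square by blast
    show "is_square (order A) \<longleftrightarrow> (\<exists>B'. perfect_pairing A B' \<and> alternating_pairing A B')"
    proof
      assume sq: "is_square (order A)"
      \<comment> \<open>The case \<open>n = 0\<close> falls to the positivity of the order.\<close>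
      have "order A \<noteq> 2 * n\<^sup>2" for n
        using sq not_is_square_twice_square[of n] card_carrier_pos
        by (cases "n = 0") (auto simp: order_def)
      then show "\<exists>B'. perfect_pairing A B' \<and> alternating_pairing A B'"
        using alternating_or_twice_square by blast
    qed (use square in blast)
    show "\<forall>e>0. (even e \<longrightarrow> of_nat (card (torsion A e)) \<sim>\<^sub>\<box> of_nat (order A)) \<and>
                (odd e \<longrightarrow> of_nat (card (torsion A e)) \<sim>\<^sub>\<box> 1)"
      using torsion_even torsion_odd by blast
  }
  fix F assume F: "F \<in> auto A" and "symmetric_pairing A B \<and> invariant_pairing A F B"
  then have sym: "b x y = b y x" and inv: "b (F x) (F y) = b x y"
    if "x \<in> carrier A" "y \<in> carrier A" for x y
    using that by (auto simp: b_def symmetric_pairing_def invariant_pairing_def)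
  have hom: "F \<in> hom A A" and surj: "F ` carrier A = carrier A"
    using F by (auto simp: auto_def Bij_def bij_betw_def)
  show "\<forall>f::int.
      (odd f \<longrightarrow> of_nat (card (fixed_subgroup A (F [^]\<^bsub>AutoGroup A\<^esub> f)))
                   \<sim>\<^sub>\<box> of_nat (card (fixed_subgroup A F))) \<and>
      (even f \<longrightarrow> of_nat (card (fixed_subgroup A (F [^]\<^bsub>AutoGroup A\<^esub> f)))
                   \<sim>\<^sub>\<box> of_nat (order A))"
  proof (intro allI conjI impI)
    fix f :: int
    {
      assume "odd f"
      then have "odd (nat \<bar>f\<bar>)" by (simp add: even_nat_iff)
      then show "of_nat (card (fixed_subgroup A (F [^]\<^bsub>AutoGroup A\<^esub> f)))
          \<sim>\<^sub>\<box> of_nat (card (fixed_subgroup A F))"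
        using b.card_fixed_odd[OF radical_trivial hom surj sym inv]
        by (simp add: fixed_subgroup_int_pow[OF F])
    }
    assume "even f"
    then have "even (nat \<bar>f\<bar>)" by (simp add: even_nat_iff)
    then obtain g where g: "nat \<bar>f\<bar> = 2 * g" by blast
    obtain m where "card (carrier A) * card (fixed_subgroup A (F ^^ (2 * g))) = m\<^sup>2"
      using b.card_fixed_even[OF radical_trivial hom surj sym inv, of g] by blast
    moreover have "\<one>\<^bsub>A\<^esub> \<in> fixed_subgroup A (F ^^ (2 * g))"
      using hom_one[OF funpow_hom[OF hom] is_group is_group] by (simp add: fixed_subgroup_def)
    then have "card (fixed_subgroup A (F ^^ (2 * g))) > 0"
      using finite_carrier by (auto simp: fixed_subgroup_def card_gt_0_iff)
    ultimately show "of_nat (card (fixed_subgroup A (F [^]\<^bsub>AutoGroup A\<^esub> f))) \<sim>\<^sub>\<box> of_nat (order A)"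
      unfolding fixed_subgroup_int_pow[OF F] g order_def
      by (intro eq_mod_squares_of_nat card_carrier_pos)
  qed
qed

end
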